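(* Let $e'$ be an ellipse in the plane $z=0$ with semiaxes $a_e'>b_e'$ along the $x$- and $y$-axis, and let $c'$ be a confocal ellipse inside $e'$ with semiaxes $a_c'>b_c'>0$; put $d'=\sqrt{a_c'^2-b_c'^2}$ and $k_e'=a_e'^2-a_c'^2=b_e'^2-b_c'^2>0$. Let $e''$ be the ellipse in the plane $y=0$ with semiaxes $a_e''=a_e'$ along the $x$-axis and $b_e''=\sqrt{k_e'}$ along the $z$-axis, and let $c''$ be the confocal hyperbola in $y=0$ with principal axis the $x$-axis and semiaxes $a_c''=d'$, $b_c''=b_c'$. Let $(P_i')_{i\in\mathbb Z}$ be a billiard in $e'$ with caustic $c'$ and let $(P_i'')_{i\in\mathbb Z}$ be its isometric counterpart, i.e. a billiard in $e''$ with caustic $c''$ such that $\overline{P_i''P_{i+1}''}=\overline{P_i'P_{i+1}'}$ and the $x$-coordinate of $P_i''$ is $d'/a_c'$ times the $x$-coordinate of $P_i'$ for all $i$. Let $\mathcal E$ be the triaxial ellipsoid through $e'$ and $e''$ (semiaxes $a_e',b_e',\sqrt{k_e'}$), whose focal ellipse is $c'$ and whose focal hyperbola is $c''$. Then the isometric transition from $(P_i')$ to $(P_i'')$ can be carried out continuously via mutually isometric focal billiards $(P_i)$ in the fixed ellipsoid $\mathcal E$: there is a continuous one-parameter family of focal billiards $(P_i(s))_{i\in\mathbb Z}$ in $\mathcal E$, $s\in[0,1]$, with $P_i(0)=P_i'$, $P_i(1)=P_i''$ and $\overline{P_i(s)P_{i+1}(s)}$ independent of $s$ for all $i$. This transition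 is an affine motion, and during it the paths of the vertices $P_i$ on $\mathcal E$ are orthogonal trajectories of the one-sheeted hyperboloids confocal with $\mathcal E$. In the two flat poses, the sides of the billiards $(P_i')$ in $e'$ and $(P_i'')$ in $e''$ are tangent to the respectively coplanar focal conics $c'$ and $c''$.
   Context: A billiard in an ellipse or ellipsoid is a sequence of points $P_i$ on it ($i\in\mathbb Z$, $P_i\neq P_{i+1}$) such that at each $P_i$ the lines $[P_{i-1},P_i]$, $[P_i,P_{i+1}]$ are interchanged by reflection in the tangent line (tangent plane) at $P_i$. A conic confocal with an ellipse is the caustic of a planar billiard if all side lines are tangent to it. The quadrics confocal with $\mathcal E$ are $\frac{x^2}{a_c'^2+k}+\frac{y^2}{b_c'^2+k}+\frac{z^2}{k}=1$, $k\in\mathbb R\setminus\{-a_c'^2,-b_c'^2,0\}$; $\mathcal E$ has $k=k_e'$; for $-b_c'^2<k<0$ they are one-sheeted hyperboloids. The focal ellipse ($k=0$) is $c'$: $\frac{x^2}{a_c'^2}+\frac{y^2}{b_c'^2}=1$, $z=0$. The focal hyperbola ($k=-b_c'^2$) is $c''$: $\frac{x^2}{a_c'^2-b_c'^2}-\frac{z^2}{b_c'^2}=1$, $y=0$. Focal axes of $\mathcal E$ are the generators (rulings) of the confocal one-sheeted hyperboloids together with the tangent lines of the two focal conics. A billiard in $\mathcal E$ is a focal billiard if each side is located on a focal axis of $\mathcal E$. "Affine motion" means that the vertices $P_i(s)$ (all $i$) of any intermediate pose, $0<s<1$, are mapped to those of any other pose by a single affine transformation of space (independent of $i$), which is singular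 if the target pose is one of the flat limits. *)

theory Defs
  imports "HOL-Analysis.Analysis"
begin

text \<open>
  Central conics in the plane and central quadrics in space, in principal axes, are given by the
  vector \<open>A\<close> of their signed squared semiaxes (negative entries for imaginary semiaxes).
\<close>

definition quadric :: "real ^ 'n \<Rightarrow> (real ^ 'n) set" where
  "quadric A = {x. (\<Sum>i\<in>UNIV. (x $ i)\<^sup>2 / A $ i) = 1}"

definition normal_vec :: "real ^ 'n \<Rightarrow> real ^ 'n \<Rightarrow> real ^ 'n" where
  "normal_vec A p = (\<chi> i. p $ i / A $ i)"

definition tangent_hyperplane :: "real ^ 'n \<Rightarrow> real ^ 'n \<Rightarrow> (real ^ 'n) set" where
  "tangent_hyperplane A p = {x. normal_vec A p \<bullet> (x - p) = 0}"

text \<open>Reflection in the tangent line (tangent plane) at \<open>p\<close>.\<close>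

definition tangent_reflection :: "real ^ 'n \<Rightarrow> real ^ 'n \<Rightarrow> real ^ 'n \<Rightarrow> real ^ 'n" where
  "tangent_reflection A p x =
     x - (2 * (normal_vec A p \<bullet> (x - p)) / (normal_vec A p \<bullet> normal_vec A p)) *\<^sub>R normal_vec A p"

definition side_line :: "(int \<Rightarrow> real ^ 'n) \<Rightarrow> int \<Rightarrow> (real ^ 'n) set" where
  "side_line P i = affine hull {P i, P (i + 1)}"

definition billiard :: "real ^ 'n \<Rightarrow> (int \<Rightarrow> real ^ 'n) \<Rightarrow> bool" where
  "billiard A P \<longleftrightarrow>
     (\<forall>i. P i \<in> quadric A \<and> P i \<noteq> P (i + 1) \<and>
          tangent_reflection A (P i) ` side_line P (i - 1) = side_line P i \<and>
          tangent_reflection A (P i) ` side_line P i = side_line P (i - 1))"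

text \<open>
  Tangent lines of a conic are understood projectively: besides the tangents at points of the conic
  they include the tangents at its points at infinity, i.e. the asymptotes of a hyperbola (an ellipse
  has none). This is needed: a side parallel to the x-axis of the billiard with an elliptic
  caustic corresponds to a side on an asymptote for the isometric billiard with a hyperbolic caustic.
\<close>

definition tangent_lines :: "real ^ 2 \<Rightarrow> (real ^ 2) set set" where
  "tangent_lines C = {tangent_hyperplane C p | p. p \<in> quadric C}
     \<union> {span {v} | v. v \<noteq> 0 \<and> (\<Sum>i\<in>UNIV. (v $ i)\<^sup>2 / C $ i) = 0}"

definition caustic :: "real ^ 2 \<Rightarrow> (int \<Rightarrow> real ^ 2) \<Rightarrow> bool" where
  "caustic C P \<longleftrightarrow> (\<forall>i. side_line P i \<in> tangent_lines C)"

definition ellipse :: "real \<Rightarrow> real \<Rightarrow> real ^ 2" where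
  "ellipse a b = vector [a\<^sup>2, b\<^sup>2]"

definition hyperbola :: "real \<Rightarrow> real \<Rightarrow> real ^ 2" where
  "hyperbola a b = vector [a\<^sup>2, - (b\<^sup>2)]"

definition ellipsoid :: "real \<Rightarrow> real \<Rightarrow> real \<Rightarrow> real ^ 3" where
  "ellipsoid a b c = vector [a\<^sup>2, b\<^sup>2, c\<^sup>2]"

text \<open>The planes \<open>z = 0\<close> and \<open>y = 0\<close> in space.\<close>

definition emb_xy :: "real ^ 2 \<Rightarrow> real ^ 3" where
  "emb_xy p = vector [p $ 1, p $ 2, 0]"

definition emb_xz :: "real ^ 2 \<Rightarrow> real ^ 3" where
  "emb_xz p = vector [p $ 1, 0, p $ 2]"

text \<open>
  For an ellipsoid \<open>A = (\<alpha>, \<beta>, \<gamma>)\<close>, \<open>\<alpha> > \<beta> > \<gamma> > 0\<close>, the confocal quadrics are normalised such that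
  the third squared semiaxis is the parameter \<open>k\<close>; the focal ellipse has the squared semiaxes
  \<open>\<alpha> - \<gamma>\<close>, \<open>\<beta> - \<gamma>\<close>, and \<open>A\<close> itself belongs to \<open>k = \<gamma>\<close>.
\<close>

definition confocal :: "real ^ 3 \<Rightarrow> real \<Rightarrow> real ^ 3" where
  "confocal A k = vector [A $ 1 - A $ 3 + k, A $ 2 - A $ 3 + k, k]"

definition focal_ellipse :: "real ^ 3 \<Rightarrow> real ^ 2" where
  "focal_ellipse A = vector [A $ 1 - A $ 3, A $ 2 - A $ 3]"

definition focal_hyperbola :: "real ^ 3 \<Rightarrow> real ^ 2" where
  "focal_hyperbola A = vector [A $ 1 - A $ 2, - (A $ 2 - A $ 3)]"

definition one_sheeted_params :: "real ^ 3 \<Rightarrow> real set" where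
  "one_sheeted_params A = {- (A $ 2 - A $ 3) <..< 0}"

lemma confocal_family:
  assumes "ke > 0" "a\<^sup>2 = ac\<^sup>2 + ke" "b\<^sup>2 = bc\<^sup>2 + ke" "bc\<^sup>2 \<le> ac\<^sup>2"
  shows "confocal (ellipsoid a b (sqrt ke)) k = vector [ac\<^sup>2 + k, bc\<^sup>2 + k, k]"
    and "confocal (ellipsoid a b (sqrt ke)) ke = ellipsoid a b (sqrt ke)"
    and "focal_ellipse (ellipsoid a b (sqrt ke)) = ellipse ac bc"
    and "focal_hyperbola (ellipsoid a b (sqrt ke)) = hyperbola (sqrt (ac\<^sup>2 - bc\<^sup>2)) bc"
    and "one_sheeted_params (ellipsoid a b (sqrt ke)) = {- (bc\<^sup>2) <..< 0}"
  using assms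
  by (simp_all add: confocal_def focal_ellipse_def focal_hyperbola_def one_sheeted_params_def
      ellipsoid_def ellipse_def hyperbola_def)

definition generators :: "real ^ 3 \<Rightarrow> (real ^ 3) set set" where
  "generators H = {affine hull {p, q} | p q. p \<noteq> q \<and> affine hull {p, q} \<subseteq> quadric H}"

definition focal_axes :: "real ^ 3 \<Rightarrow> (real ^ 3) set set" where
  "focal_axes A = (\<Union>k\<in>one_sheeted_params A. generators (confocal A k))
     \<union> (`) emb_xy ` tangent_lines (focal_ellipse A)
     \<union> (`) emb_xz ` tangent_lines (focal_hyperbola A)"

definition focal_billiard :: "real ^ 3 \<Rightarrow> (int \<Rightarrow> real ^ 3) \<Rightarrow> bool" where
  "focal_billiard A P \<longleftrightarrow> billiard A P \<and> (\<forall>i. side_line P i \<in> focal_axes A)"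

text \<open>
  The affine map \<open>x \<mapsto> g x + c\<close> may depend on \<open>s\<close> and \<open>t\<close>, but not on the vertex \<open>i\<close>.
\<close>

definition affine_motion :: "(real \<Rightarrow> int \<Rightarrow> real ^ 3) \<Rightarrow> bool" where
  "affine_motion P \<longleftrightarrow>
     (\<forall>s\<in>{0<..<1}. \<forall>t\<in>{0..1}. \<exists>g c. linear g \<and>
        (\<forall>i. P t i = g (P s i) + c) \<and> (bij g \<longleftrightarrow> t \<in> {0<..<1}))"

text \<open>
  A curve, parametrised over \<open>0 < s < 1\<close>, is an orthogonal trajectory of the confocal one-sheeted
  hyperboloids if it is regular, runs inside the region covered by these surfaces and meets each of
  them orthogonally.
\<close>

definition orthogonal_trajectory :: "real ^ 3 \<Rightarrow> (real \<Rightarrow> real ^ 3) \<Rightarrow> bool" where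
  "orthogonal_trajectory A p \<longleftrightarrow>
     (\<forall>s\<in>{0<..<1}.
        (\<exists>k\<in>one_sheeted_params A. p s \<in> quadric (confocal A k)) \<and>
        (\<exists>v. v \<noteq> 0 \<and> (p has_vector_derivative v) (at s) \<and>
           (\<forall>k\<in>one_sheeted_params A. p s \<in> quadric (confocal A k) \<longrightarrow>
              v \<in> span {normal_vec (confocal A k) (p s)})))"

end

theory Submission
  imports Defs
begin

text \<open>
  Merge corresponding vertices of the two flat billiards into the points
  \<open>Q\<^sub>i = (x'\<^sub>i, y'\<^sub>i, z''\<^sub>i)\<close>. They lie on the quadric \<open>H: x\<^sup>2/a\<^sub>c\<^sup>2 + y\<^sup>2/b\<^sub>c\<^sup>2 - z\<^sup>2/b\<^sub>c\<^sup>2 = 1\<close>, and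
  \<open>P\<^sub>i(s)\<close> is the image of \<open>Q\<^sub>i\<close> under the diagonal map that sends \<open>H\<close> to the confocal hyperboloid with
  parameter \<open>k = -s b\<^sub>c\<^sup>2\<close>. Squared side lengths of \<open>P(s)\<close> are affine functions of \<open>s\<close>; they agree at
  \<open>s = 0\<close> and \<open>s = 1\<close>, so they are constant. The vanishing slope says precisely that \<open>Q\<^bsub>i+1\<^esub> - Q\<^sub>i\<close> is
  isotropic for \<open>H\<close>, i.e. that the sides are generators. The reflection law says that the difference
  of consecutive unit directions is a multiple of the normal; at each vertex the multiples for the
  two flat poses agree because sides are tangent to \<open>H\<close>, and then the law carries over to all poses.
\<close>

section \<open>Chords of central quadrics\<close>

lemma quadric_chord:
  assumes p: "p \<in> quadric A" and q: "q \<in> quadric A"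
  shows "normal_vec A p \<bullet> (q - p) = - (\<Sum>i\<in>UNIV. ((q - p) $ i)\<^sup>2 / A $ i) / 2"
proof -
  \<comment> \<open>Polarisation of the quadratic form of \<open>A\<close>. The entries of
    \<open>A\<close> may have any signs, so this serves both the ellipsoid and the hyperboloid
    \<open>H\<close>.\<close>
  have "(\<Sum>i\<in>UNIV. ((q - p) $ i)\<^sup>2 / A $ i) =
      (\<Sum>i\<in>UNIV. (q $ i)\<^sup>2 / A $ i) - (\<Sum>i\<in>UNIV. (p $ i)\<^sup>2 / A $ i)
      - 2 * (\<Sum>i\<in>UNIV. p $ i / A $ i * (q - p) $ i)"
    unfolding sum_subtractf[symmetric] sum_distrib_left
    by (intro sum.cong refl)
      (simp add: power2_eq_square diff_divide_distrib add_divide_distrib algebra_simps)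
  with p q show ?thesis
    by (simp add: quadric_def normal_vec_def inner_vec_def)
qed

text \<open>Positive entries make the form definite, so the quadric is strictly convex and
  \<open>normal_vec A p\<close> points outwards. This supplies the signs in the reflection
  law.\<close>

lemma quadric_chord_neg:
  assumes "\<And>i. A $ i > 0" "p \<in> quadric A" "q \<in> quadric A" "p \<noteq> q"
  shows "normal_vec A p \<bullet> (q - p) < 0"
proof -
  obtain j where "p $ j \<noteq> q $ j"
    using \<open>p \<noteq> q\<close> by (auto simp: vec_eq_iff)
  then have "(\<Sum>i\<in>UNIV. ((q - p) $ i)\<^sup>2 / A $ i) > 0"
    using assms(1) by (intro sum_pos2[where i = j]) (auto simp: less_imp_le)
  then show ?thesis
    using quadric_chord[OF assms(2,3)] by simp
qed

text \<open>Along the line the form is a polynomial of degree two in the parameter. Its quadratic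
  coefficient vanishes by isotropy, hence by \<open>quadric_chord\<close> so does the linear one,
  and the constant 1 remains. This is how sides are recognised as generators.\<close>

lemma isotropic_chord_subset_quadric:
  assumes p: "p \<in> quadric A" and q: "q \<in> quadric A"
    and iso: "(\<Sum>i\<in>UNIV. ((q - p) $ i)\<^sup>2 / A $ i) = 0"
  shows "affine hull {p, q} \<subseteq> quadric A"
proof
  fix x assume "x \<in> affine hull {p, q}"
  then obtain t where x: "x = p + t *\<^sub>R (q - p)"
    unfolding affine_hull_2_alt by auto
  have "(\<Sum>i\<in>UNIV. (x $ i)\<^sup>2 / A $ i) = (\<Sum>i\<in>UNIV. (p $ i)\<^sup>2 / A $ i)
      + 2 * t * (normal_vec A p \<bullet> (q - p)) + t\<^sup>2 * (\<Sum>i\<in>UNIV. ((q - p) $ i)\<^sup>2 / A $ i)"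
    unfolding inner_vec_def sum_distrib_left sum.distrib[symmetric] x
    by (intro sum.cong refl)
      (simp add: normal_vec_def power2_eq_square diff_divide_distrib add_divide_distrib algebra_simps)
  then show "x \<in> quadric A"
    using p iso quadric_chord[OF p q] by (simp add: quadric_def)
qed

section \<open>Reflections in tangent hyperplanes and the reflection law for unit directions\<close>

definition reflect_dir :: "real ^ 'n \<Rightarrow> real ^ 'n \<Rightarrow> real ^ 'n" where
  "reflect_dir n u = u - (2 * (n \<bullet> u) / (n \<bullet> n)) *\<^sub>R n"

lemma linear_reflect_dir: "linear (reflect_dir n)"
  by (rule linearI) (simp_all add: reflect_dir_def inner_add_right algebra_simps add_divide_distrib)

lemma inner_reflect_dir: "n \<bullet> reflect_dir n u = - (n \<bullet> u)"
  by (cases "n = 0") (simp_all add: reflect_dir_def inner_diff_right)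

lemma norm_reflect_dir: "norm (reflect_dir n u) = norm u"
proof -
  have "reflect_dir n u \<bullet> reflect_dir n u = u \<bullet> u"
    by (cases "n = 0")
      (simp_all add: reflect_dir_def inner_diff_right inner_diff_left inner_commute)
  then show ?thesis by (simp add: norm_eq)
qed

lemma reflect_dir_involution: "reflect_dir n (reflect_dir n u) = u"
  by (subst reflect_dir_def) (simp add: inner_reflect_dir, simp add: reflect_dir_def)

lemma sgn_reflect_dir: "sgn (reflect_dir n u) = reflect_dir n (sgn u)"
  by (simp add: sgn_div_norm norm_reflect_dir linear_cmul[OF linear_reflect_dir])

lemma tangent_reflection_eq:
  "tangent_reflection A p x = p + reflect_dir (normal_vec A p) (x - p)"
  by (simp add: tangent_reflection_def reflect_dir_def)

lemma tangent_reflection_involution: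
  "tangent_reflection A p (tangent_reflection A p x) = x"
  by (simp add: tangent_reflection_eq reflect_dir_involution)

text \<open>The reflection is a linear map conjugated by a translation, so it commutes with affine
  hulls; and it fixes \<open>p\<close>.\<close>

lemma tangent_reflection_affine_hull:
  "tangent_reflection A p ` (affine hull {x, p}) = affine hull {tangent_reflection A p x, p}"
proof -
  have eq: "tangent_reflection A p = (\<lambda>y. p + y) \<circ> reflect_dir (normal_vec A p) \<circ> (\<lambda>y. - p + y)"
    by (auto simp: tangent_reflection_eq)
  have "tangent_reflection A p ` (affine hull S) = affine hull (tangent_reflection A p ` S)" for S
    unfolding eq image_comp[symmetric]
    by (simp only: affine_hull_translation[symmetric]
        affine_hull_linear_image[OF linear_conv_bounded_linear[THEN iffD1, OF linear_reflect_dir]])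
  then show ?thesis
    by (simp add: tangent_reflection_eq linear_0[OF linear_reflect_dir])
qed

lemma affine_hull_2_cong:
  assumes "x \<in> affine hull {p, q}" "x \<noteq> p"
  shows "affine hull {x, p} = affine hull {p, q}"
proof -
  obtain t where x: "x = p + t *\<^sub>R (q - p)"
    using assms(1) unfolding affine_hull_2_alt by auto
  with assms(2) have t: "t \<noteq> 0" by auto
  have "affine hull {p, x} = range (\<lambda>u. p + (u * t) *\<^sub>R (q - p))"
    unfolding affine_hull_2_alt x by simp
  also have "\<dots> = range (\<lambda>u. p + u *\<^sub>R (q - p))"
  proof (intro equalityI subsetI)
    fix y assume "y \<in> range (\<lambda>u. p + u *\<^sub>R (q - p))"
    then obtain u where "y = p + ((u / t) * t) *\<^sub>R (q - p)"
      using t by auto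
    then show "y \<in> range (\<lambda>u. p + (u * t) *\<^sub>R (q - p))" by blast
  qed auto
  finally show ?thesis
    by (simp add: affine_hull_2_alt insert_commute)
qed

text \<open>Convexity of the quadric fixes the orientation, which the lines in \<open>billiard\<close> do not carry.\<close>

lemma billiard_iff:
  assumes pos: "\<And>j. A $ j > 0"
    and P: "\<And>i. P i \<in> quadric A" and ne: "\<And>i. P i \<noteq> P (i + 1)"
  shows "billiard A P \<longleftrightarrow>
    (\<forall>i. \<exists>c. sgn (P (i + 1) - P i) - sgn (P i - P (i - 1)) = c *\<^sub>R normal_vec A (P i))"
    (is "_ \<longleftrightarrow> (\<forall>i. ?L i)")
proof -
  define n where "n i = normal_vec A (P i)" for i
  have ne': "P (i - 1) \<noteq> P i" for i
    using ne[of "i - 1"] by simp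
  \<comment> \<open>With the normals pointing outwards, the trajectory leaves each vertex inwards
    and, by \<open>bwd\<close>, arrives there outwards.\<close>
  have fwd: "n i \<bullet> (P (i + 1) - P i) < 0" for i
    unfolding n_def by (intro quadric_chord_neg pos P ne)
  have bwd: "n i \<bullet> (P i - P (i - 1)) > 0" for i
    using quadric_chord_neg[OF pos P P, of i "i - 1"] ne'[of i] unfolding n_def
    by (simp add: inner_diff_right)
  \<comment> \<open>On the line through \<open>u\<close> in direction \<open>n i\<close> only
    \<open>u\<close> and its mirror image have the norm of \<open>u\<close>. The opposite signs in
    \<open>fwd\<close> and \<open>bwd\<close> exclude \<open>c = 0\<close>, so the mirror image is
    left.\<close>
  have L_iff: "?L i \<longleftrightarrow> sgn (P (i + 1) - P i) = reflect_dir (n i) (sgn (P i - P (i - 1)))" for i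
  proof
    assume "?L i"
    then obtain c where c: "sgn (P (i + 1) - P i) = sgn (P i - P (i - 1)) + c *\<^sub>R n i"
      unfolding n_def by (auto simp: algebra_simps)
    define u where "u = sgn (P i - P (i - 1))"
    have "n i \<bullet> sgn (P (i + 1) - P i) < 0" "n i \<bullet> u > 0"
      using fwd[of i] bwd[of i] ne[of i] ne'[of i]
      by (auto simp: u_def sgn_div_norm divide_simps mult_less_0_iff zero_less_mult_iff)
    then have c0: "c \<noteq> 0" and n0: "n i \<noteq> 0"
      using c unfolding u_def by auto
    have "norm (u + c *\<^sub>R n i) = norm u"
      unfolding u_def c[symmetric] using ne[of i] ne'[of i] by (simp add: norm_sgn)
    then have "(u + c *\<^sub>R n i) \<bullet> (u + c *\<^sub>R n i) = u \<bullet> u"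
      by (simp add: norm_eq)
    then have "c * (2 * (n i \<bullet> u) + c * (n i \<bullet> n i)) = 0"
      by (simp add: inner_add_left inner_add_right inner_commute algebra_simps)
    with c0 have "c * (n i \<bullet> n i) = - (2 * (n i \<bullet> u))" by (simp add: add_eq_0_iff)
    with n0 have "c = - (2 * (n i \<bullet> u)) / (n i \<bullet> n i)"
      by (simp add: field_simps)
    then show "sgn (P (i + 1) - P i) = reflect_dir (n i) (sgn (P i - P (i - 1)))"
      unfolding c reflect_dir_def u_def by simp
  next
    assume "sgn (P (i + 1) - P i) = reflect_dir (n i) (sgn (P i - P (i - 1)))"
    then show "?L i"
      by (intro exI[of _ "- (2 * (n i \<bullet> sgn (P i - P (i - 1))) / (n i \<bullet> n i))"])
        (simp add: reflect_dir_def n_def)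
  qed
  have line: "side_line P (i - 1) = affine hull {P (i - 1), P i}" for i
    by (simp add: side_line_def)
  have R_diff: "tangent_reflection A (P i) (P (i - 1)) - P i = - reflect_dir (n i) (P i - P (i - 1))" for i
    using linear_neg[OF linear_reflect_dir, of "n i" "P i - P (i - 1)"]
    by (simp add: tangent_reflection_eq n_def)
  have refl_iff: "sgn (P (i + 1) - P i) = reflect_dir (n i) (sgn (P i - P (i - 1))) \<longleftrightarrow>
      tangent_reflection A (P i) ` side_line P (i - 1) = side_line P i" for i
  proof
    assume *: "sgn (P (i + 1) - P i) = reflect_dir (n i) (sgn (P i - P (i - 1)))"
    \<comment> \<open>Reflection preserves length, so the image of \<open>P (i - 1)\<close> lies on
      the extension of the next side beyond \<open>P i\<close>, as far away as the previous side is
      long; \<open>l\<close> measures this in units of the next side.\<close>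
    define l where "l = norm (P i - P (i - 1)) / norm (P (i + 1) - P i)"
    have "reflect_dir (n i) (P i - P (i - 1)) = norm (P i - P (i - 1)) *\<^sub>R sgn (P (i + 1) - P i)"
      unfolding * linear_cmul[OF linear_reflect_dir, symmetric]
      using ne'[of i] by (simp add: sgn_div_norm)
    also have "\<dots> = l *\<^sub>R (P (i + 1) - P i)"
      by (simp add: sgn_div_norm l_def divide_inverse)
    finally have R: "tangent_reflection A (P i) (P (i - 1)) = P i + (- l) *\<^sub>R (P (i + 1) - P i)"
      using R_diff[of i] by (metis diff_eq_eq add.commute scaleR_minus_left)
    moreover have "l \<noteq> 0"
      using ne[of i] ne'[of i] by (simp add: l_def)
    ultimately have "tangent_reflection A (P i) (P (i - 1)) \<noteq> P i"
      using ne[of i] by simp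
    moreover have "tangent_reflection A (P i) (P (i - 1)) \<in> affine hull {P i, P (i + 1)}"
      unfolding affine_hull_2_alt using R by blast
    ultimately show "tangent_reflection A (P i) ` side_line P (i - 1) = side_line P i"
      unfolding line tangent_reflection_affine_hull
      by (simp add: side_line_def affine_hull_2_cong)
  next
    assume "tangent_reflection A (P i) ` side_line P (i - 1) = side_line P i"
    moreover have "P (i - 1) \<in> side_line P (i - 1)"
      unfolding line by (intro hull_inc) simp
    ultimately have "tangent_reflection A (P i) (P (i - 1)) \<in> affine hull {P i, P (i + 1)}"
      unfolding side_line_def[of P i] by blast
    then obtain t where "tangent_reflection A (P i) (P (i - 1)) = P i + t *\<^sub>R (P (i + 1) - P i)"
      unfolding affine_hull_2_alt by auto
    then have R: "reflect_dir (n i) (P i - P (i - 1)) = (- t) *\<^sub>R (P (i + 1) - P i)"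
      using R_diff[of i] by (metis add_diff_cancel_left' minus_minus scaleR_minus_left)
    \<comment> \<open>Equality of lines determines the reflected direction only up to a factor
      \<open>- t\<close> of unknown sign; pairing with the normal shows that it is positive.\<close>
    have "- (n i \<bullet> (P i - P (i - 1))) = - t * (n i \<bullet> (P (i + 1) - P i))"
      using arg_cong[OF R, of "\<lambda>v. n i \<bullet> v"]
      by (simp add: inner_reflect_dir)
    then have "(- t) * (n i \<bullet> (P (i + 1) - P i)) < 0"
      using bwd[of i] by linarith
    then have "- t > 0"
      using fwd[of i] by (simp add: mult_less_0_iff zero_less_mult_iff)
    then show "sgn (P (i + 1) - P i) = reflect_dir (n i) (sgn (P i - P (i - 1)))"
      using arg_cong[OF R, of sgn] by (simp only: sgn_reflect_dir sgn_scaleR) simp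
  qed
  have reverse: "tangent_reflection A (P i) ` side_line P i = side_line P (i - 1)"
    if "tangent_reflection A (P i) ` side_line P (i - 1) = side_line P i" for i
    unfolding that [symmetric] image_image tangent_reflection_involution by simp
  show ?thesis
    unfolding L_iff refl_iff billiard_def using P ne reverse by blast
qed

section \<open>Diagonal maps, linear images of sides, and confocal quadrics\<close>

definition diag_map :: "real ^ 'n \<Rightarrow> real ^ 'n \<Rightarrow> real ^ 'n" where
  "diag_map r x = (\<chi> i. r $ i * x $ i)"

lemma diag_map_nth [simp]: "diag_map r x $ i = r $ i * x $ i"
  by (simp add: diag_map_def)

lemma linear_diag_map: "linear (diag_map r)"
  by (rule linearI) (simp_all add: vec_eq_iff algebra_simps)

lemma diag_map_diff: "diag_map r (x - y) = diag_map r x - diag_map r y"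
  by (rule linear_diff[OF linear_diag_map])

lemma bij_diag_map_iff: "bij (diag_map r) \<longleftrightarrow> (\<forall>i. r $ i \<noteq> 0)"
proof
  assume bij: "bij (diag_map r)"
  show "\<forall>i. r $ i \<noteq> 0"
  proof (intro allI notI)
    fix i assume "r $ i = 0"
    then have "diag_map r (axis i 1) = diag_map r 0"
      by (auto simp: vec_eq_iff axis_def)
    then have "axis i (1 :: real) = (0 :: real ^ 'a)"
      using bij by (meson bij_is_inj injD)
    then show False by (simp add: axis_eq_0_iff)
  qed
next
  assume "\<forall>i. r $ i \<noteq> 0"
  then show "bij (diag_map r)"
    by (intro bij_betw_byWitness[where f' = "diag_map (\<chi> i. inverse (r $ i))"])
      (auto simp: vec_eq_iff)
qed

lemma diag_map_quadric_iff:
  assumes "\<And>i. r $ i \<noteq> 0" "\<And>i. B $ i = (r $ i)\<^sup>2 * A $ i"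
  shows "diag_map r x \<in> quadric B \<longleftrightarrow> x \<in> quadric A"
  using assms by (simp add: quadric_def power_mult_distrib)

lemma side_line_linear_image:
  assumes "linear f"
  shows "side_line (\<lambda>i. f (P i)) j = f ` side_line P j"
  using affine_hull_linear_image[of f "{P j, P (j + 1)}"] assms
  by (simp add: side_line_def linear_conv_bounded_linear)

lemma linear_emb_xy: "linear emb_xy" and linear_emb_xz: "linear emb_xz"
  by (auto intro!: linearI simp: emb_xy_def emb_xz_def vec_eq_iff forall_3)

text \<open>For fixed \<open>p\<close> each term of the equation decreases in the parameter as long
  as its denominator keeps its sign, which holds throughout the interval of one-sheeted
  hyperboloids. Since \<open>p\<close> is not 0, the sum decreases strictly and takes the value 1 at
  most once. Hence an orthogonal trajectory has to be compared with one normal only at each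
  point.\<close>

lemma quadric_confocal_unique:
  fixes A :: "real ^ 3"
  assumes "A $ 2 > A $ 3" "A $ 1 > A $ 2" "k \<in> one_sheeted_params A" "l \<in> one_sheeted_params A"
    and "p \<in> quadric (confocal A k)" "p \<in> quadric (confocal A l)"
  shows "k = l"
proof -
  have less: False
    if kl: "k < l" and kb: "- (A $ 2 - A $ 3) < k" and l0: "l < 0"
      and pk: "p \<in> quadric (confocal A k)" and pl: "p \<in> quadric (confocal A l)" for k l
  proof -
    define a where "a = A $ 1 - A $ 3"
    define b where "b = A $ 2 - A $ 3"
    have pos: "a + k > 0" "b + k > 0" "a + l > 0" "b + l > 0" "k < 0"
      using assms(1,2) kl kb l0 by (auto simp: a_def b_def)
    have mono: "v\<^sup>2 / (x + l) \<le> v\<^sup>2 / (x + k) \<and> (v \<noteq> 0 \<longrightarrow> v\<^sup>2 / (x + l) < v\<^sup>2 / (x + k))"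
      if "(x + k) * (x + l) > 0" for v x
      using that kl by (auto simp: frac_le zero_less_mult_iff divide_left_mono divide_strict_left_mono mult.commute)
    have "p $ 1 \<noteq> 0 \<or> p $ 2 \<noteq> 0 \<or> p $ 3 \<noteq> 0"
      using pk by (auto simp: quadric_def sum_3)
    moreover have "(a + k) * (a + l) > 0" "(b + k) * (b + l) > 0" "(0 + k) * (0 + l) > 0"
      using pos l0 by (auto simp: mult_neg_neg)
    note mono[OF this(1), of "p $ 1"] mono[OF this(2), of "p $ 2"] mono[OF this(3), of "p $ 3"]
    ultimately have "(p $ 1)\<^sup>2 / (a + l) + (p $ 2)\<^sup>2 / (b + l) + (p $ 3)\<^sup>2 / l
        < (p $ 1)\<^sup>2 / (a + k) + (p $ 2)\<^sup>2 / (b + k) + (p $ 3)\<^sup>2 / k"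
      by auto
    then show False
      using pk pl by (simp add: quadric_def confocal_def sum_3 a_def b_def)
  qed
  show ?thesis
    using less[of k l] less[of l k] assms(3-) by (cases k l rule: linorder_cases) (auto simp: one_sheeted_params_def)
qed

lemma normal_vec_nonzero: "p \<in> quadric A \<Longrightarrow> normal_vec A p \<noteq> 0"
proof
  assume "p \<in> quadric A" "normal_vec A p = 0"
  moreover have "normal_vec A p \<bullet> p = (\<Sum>i\<in>UNIV. (p $ i)\<^sup>2 / A $ i)"
    by (simp add: normal_vec_def inner_vec_def power2_eq_square)
  ultimately show False
    by (simp add: quadric_def)
qed

lemma has_vector_derivative_vec:
  fixes f :: "real \<Rightarrow> real ^ 'n"
  assumes "\<And>j. ((\<lambda>s. f s $ j) has_real_derivative v $ j) F"
  shows "(f has_vector_derivative v) F"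
proof -
  have expand: "x = (\<Sum>j\<in>UNIV. x $ j *\<^sub>R axis j 1)" for x :: "real ^ 'n"
    using basis_expansion[of x] by (simp add: scalar_mult_eq_scaleR)
  have "((\<lambda>s. \<Sum>j\<in>UNIV. f s $ j *\<^sub>R axis j (1 :: real)) has_vector_derivative
      (\<Sum>j\<in>UNIV. v $ j *\<^sub>R axis j 1)) F"
    using assms
    by (intro has_vector_derivative_sum bounded_linear.has_vector_derivative[OF bounded_linear_scaleR_left])
      (simp add: has_real_derivative_iff_has_vector_derivative)
  then show ?thesis
    by (simp flip: expand)
qed

text \<open>Here \<open>A\<close>, \<open>B\<close>, \<open>K\<close> stand for the squares of
  \<open>ac\<close> and \<open>bc\<close> and for \<open>ke\<close>, and \<open>(x, y, z)\<close> is
  a merged vertex. The hypotheses are linear in the squares of the coordinates and leave the single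
  free parameter \<open>X\<close>, in which the conclusions are linear identities. They place the
  vertex on \<open>H\<close>, make the normals of \<open>H\<close> and of the ellipsoid orthogonal
  there, and keep the scaled vertex on the ellipsoid.\<close>

lemma merged_vertex:
  fixes A B K x y z :: real
  assumes "A > 0" "B > 0" "K > 0"
    and y: "x\<^sup>2 / (A + K) + y\<^sup>2 / (B + K) = 1"
    and z: "(A - B) / A * x\<^sup>2 / (A + K) + z\<^sup>2 / K = 1"
  shows "x\<^sup>2 / A + y\<^sup>2 / B - z\<^sup>2 / B = 1"
    and "x\<^sup>2 / (A * (A + K)) + y\<^sup>2 / (B * (B + K)) = z\<^sup>2 / (B * K)"
    and "(1 - s * B / A) * x\<^sup>2 / (A + K) + (1 - s) * y\<^sup>2 / (B + K) + s * z\<^sup>2 / K = 1"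
proof -
  define X where "X = x\<^sup>2 / (A * (A + K))"
  have nz: "A \<noteq> 0" "B \<noteq> 0" "K \<noteq> 0" "A + K \<noteq> 0" "B + K \<noteq> 0"
    using assms by auto
  have x2: "x\<^sup>2 = (A + K) * (A * X)"
    using nz by (simp add: X_def)
  have "y\<^sup>2 / (B + K) = 1 - A * X"
    using y nz by (simp add: x2)
  then have y2: "y\<^sup>2 = (B + K) * (1 - A * X)"
    using nz by (metis nonzero_mult_div_cancel_left times_divide_eq_right)
  have "(A - B) / A * x\<^sup>2 / (A + K) = (A - B) * X"
    using nz by (simp add: x2)
  then have "z\<^sup>2 / K = 1 - (A - B) * X"
    using z by simp
  then have z2: "z\<^sup>2 = K * (1 - (A - B) * X)"
    using nz by (metis nonzero_mult_div_cancel_left times_divide_eq_right)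
  have "x\<^sup>2 / A = (A + K) * X"
    using nz by (simp add: x2)
  moreover have "y\<^sup>2 - z\<^sup>2 = B * (1 - (A + K) * X)"
    unfolding y2 z2 by (simp add: algebra_simps)
  then have "y\<^sup>2 / B - z\<^sup>2 / B = 1 - (A + K) * X"
    using nz by (simp flip: diff_divide_distrib)
  ultimately show "x\<^sup>2 / A + y\<^sup>2 / B - z\<^sup>2 / B = 1"
    by simp
  have "x\<^sup>2 / (A * (A + K)) = X" "y\<^sup>2 / (B * (B + K)) = (1 - A * X) / B"
    "z\<^sup>2 / (B * K) = (1 - (A - B) * X) / B"
    using nz by (simp_all add: X_def y2 z2)
  moreover have "X + (1 - A * X) / B = (1 - (A - B) * X) / B"
    using nz by (simp add: field_simps)
  ultimately show "x\<^sup>2 / (A * (A + K)) + y\<^sup>2 / (B * (B + K)) = z\<^sup>2 / (B * K)"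
    by simp
  have "(1 - s * B / A) * x\<^sup>2 / (A + K) = (A - s * B) * X"
    using nz by (simp add: x2) (simp add: algebra_simps)
  moreover have "(1 - s) * y\<^sup>2 / (B + K) = (1 - s) * (1 - A * X)" "s * z\<^sup>2 / K = s * (1 - (A - B) * X)"
    using nz by (simp_all add: y2 z2)
  ultimately show "(1 - s * B / A) * x\<^sup>2 / (A + K) + (1 - s) * y\<^sup>2 / (B + K) + s * z\<^sup>2 / K = 1"
    by (simp add: algebra_simps)
qed

section \<open>The transition between the two flat billiards\<close>

theorem theorem3:
  fixes ae be ac bc d ke :: real
    and P' P'' :: "int \<Rightarrow> real ^ 2"
    and E :: "real ^ 3"
  assumes "ae > be" and "be > 0" and "ac > bc" and "bc > 0"
    and "d = sqrt (ac\<^sup>2 - bc\<^sup>2)"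
    and "ke = ae\<^sup>2 - ac\<^sup>2" and "ke = be\<^sup>2 - bc\<^sup>2" and "ke > 0"
    and "billiard (ellipse ae be) P'" and "caustic (ellipse ac bc) P'"
    and "billiard (ellipse ae (sqrt ke)) P''" and "caustic (hyperbola d bc) P''"
    and "\<And>i. dist (P'' i) (P'' (i + 1)) = dist (P' i) (P' (i + 1))"
    and "\<And>i. P'' i $ 1 = d / ac * P' i $ 1"
    and "E = ellipsoid ae be (sqrt ke)"
  shows "\<exists>P :: real \<Rightarrow> int \<Rightarrow> real ^ 3.
      (\<forall>i. continuous_on {0..1} (\<lambda>s. P s i))
    \<and> (\<forall>s\<in>{0..1}. focal_billiard E (P s))
    \<and> (\<forall>i. P 0 i = emb_xy (P' i))
    \<and> (\<forall>i. P 1 i = emb_xz (P'' i))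
    \<and> (\<forall>s\<in>{0..1}. \<forall>t\<in>{0..1}. \<forall>i. dist (P s i) (P s (i + 1)) = dist (P t i) (P t (i + 1)))
    \<and> affine_motion P
    \<and> (\<forall>i. orthogonal_trajectory E (\<lambda>s. P s i))
    \<and> (\<forall>i. side_line (P 0) i \<in> (`) emb_xy ` tangent_lines (focal_ellipse E))
    \<and> (\<forall>i. side_line (P 1) i \<in> (`) emb_xz ` tangent_lines (focal_hyperbola E))"
proof -
  \<comment> \<open>For \<open>s\<close> in the unit interval, the squares of the entries are the
    ratios of the squared semiaxes of \<open>confocal E (k s)\<close> to those of \<open>H\<close>.
    At \<open>s = 0\<close> the third entry vanishes and at \<open>s = 1\<close> the second, which
    flattens the billiard.\<close>
  define r :: "real \<Rightarrow> real ^ 3" where "r s = vector [sqrt (1 - s * bc\<^sup>2 / ac\<^sup>2), sqrt (1 - s), sqrt s]" for s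
  define Q :: "int \<Rightarrow> real ^ 3" where "Q i = vector [P' i $ 1, P' i $ 2, P'' i $ 2]" for i
  define P where "P s i = diag_map (r s) (Q i)" for s i
  define H :: "real ^ 3" where "H = vector [ac\<^sup>2, bc\<^sup>2, - (bc\<^sup>2)]"
  define L where "L i = dist (P' i) (P' (i + 1))" for i
  define k where "k s = - (s * bc\<^sup>2)" for s

  have ac: "ac > 0" and ae: "ae > 0" and sq: "ac\<^sup>2 > bc\<^sup>2" "bc\<^sup>2 > 0" and ac2: "ac\<^sup>2 > 0"
    using assms(1-4) by (auto intro!: power_strict_mono)
  have ae2: "ae\<^sup>2 = ac\<^sup>2 + ke" and be2: "be\<^sup>2 = bc\<^sup>2 + ke"
    using assms(6,7) by auto
  have ke2: "(sqrt ke)\<^sup>2 = ke" and d2: "d\<^sup>2 = ac\<^sup>2 - bc\<^sup>2"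
    using \<open>ke > 0\<close> sq assms(5) by auto
  have E_nth: "E $ 1 = ac\<^sup>2 + ke" "E $ 2 = bc\<^sup>2 + ke" "E $ 3 = ke"
    using ae2 be2 ke2 assms(15) by (simp_all add: ellipsoid_def)
  have E_pos: "E $ j > 0" for j
    using E_nth \<open>ke > 0\<close> sq exhaust_3[of j] by (auto intro!: add_pos_pos)
  have focal: "focal_ellipse E = ellipse ac bc" "focal_hyperbola E = hyperbola d bc"
    "one_sheeted_params E = {- (bc\<^sup>2) <..< 0}"
    using confocal_family[of ke ae ac be bc] \<open>ke > 0\<close> ae2 be2 sq assms(5,15) by auto

  have frac: "s * bc\<^sup>2 / ac\<^sup>2 < 1" if "s \<le> 1" for s
  proof -
    have "s * bc\<^sup>2 \<le> 1 * bc\<^sup>2"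
      using that by (intro mult_right_mono) auto
    then have "s * bc\<^sup>2 < ac\<^sup>2"
      using sq by linarith
    then show ?thesis
      using ac2 by (simp add: divide_less_eq)
  qed
  have r2: "(r s $ 1)\<^sup>2 = 1 - s * bc\<^sup>2 / ac\<^sup>2" "(r s $ 2)\<^sup>2 = 1 - s" "(r s $ 3)\<^sup>2 = s"
    if "s \<in> {0..1}" for s
    using that frac[of s] by (simp_all add: r_def)
  have r_nz: "(\<forall>j. r s $ j \<noteq> 0) \<longleftrightarrow> s \<in> {0<..<1}" if "s \<in> {0..1}" for s
  proof -
    have "sqrt (1 - s * bc\<^sup>2 / ac\<^sup>2) > 0"
      using that frac[of s] by (subst real_sqrt_gt_0_iff) simp
    then have "r s $ 1 \<noteq> 0"
      unfolding r_def vector_3 by (rule less_imp_neq[symmetric])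
    moreover have "r s $ 2 \<noteq> 0 \<longleftrightarrow> s \<noteq> 1" "r s $ 3 \<noteq> 0 \<longleftrightarrow> s \<noteq> 0"
      by (simp_all add: r_def)
    ultimately show ?thesis
      using that by (auto simp: forall_3)
  qed

  \<comment> \<open>Vertices on the ellipsoid and the two flat poses\<close>
  have P'E: "P' i \<in> quadric (ellipse ae be)" and P''E: "P'' i \<in> quadric (ellipse ae (sqrt ke))" for i
    using assms(9,11) by (auto simp: billiard_def)
  have eq1: "(P' i $ 1)\<^sup>2 / (ac\<^sup>2 + ke) + (P' i $ 2)\<^sup>2 / (bc\<^sup>2 + ke) = 1" for i
    using P'E[of i] ae2 be2 by (simp add: quadric_def ellipse_def sum_2)
  have eq2: "(ac\<^sup>2 - bc\<^sup>2) / ac\<^sup>2 * (P' i $ 1)\<^sup>2 / (ac\<^sup>2 + ke) + (P'' i $ 2)\<^sup>2 / ke = 1" for i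
    using P''E[of i] ae2 ke2 d2
    by (simp add: quadric_def ellipse_def sum_2 assms(14) power_mult_distrib power_divide)
  note merged = merged_vertex[OF ac2 sq(2) \<open>ke > 0\<close> eq1 eq2]
  have QH: "Q i \<in> quadric H" for i
    using merged(1)[of i] by (simp add: quadric_def sum_3 Q_def H_def)
  have PE: "P s i \<in> quadric E" if "s \<in> {0..1}" for s i
    using merged(3)[of s i] r2[OF that] E_nth
    by (simp add: quadric_def sum_3 P_def Q_def power_mult_distrib)

  have P0: "P 0 i = emb_xy (P' i)" for i
    by (simp add: P_def r_def Q_def emb_xy_def vec_eq_iff forall_3)
  \<comment> \<open>The first entry of \<open>r 1\<close> is exactly the given ratio of the
    x-coordinates.\<close>
  have "sqrt (1 - bc\<^sup>2 / ac\<^sup>2) = d / ac"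
    using ac sq d2 assms(5)
    by (intro real_sqrt_unique) (auto simp: power_divide diff_divide_distrib)
  then have P1: "P 1 i = emb_xz (P'' i)" for i
    by (simp add: P_def r_def Q_def emb_xz_def vec_eq_iff forall_3 assms(14))

  \<comment> \<open>Constancy of the side lengths\<close>
  have ne: "P' i \<noteq> P' (i + 1)" for i
    using assms(9) by (auto simp: billiard_def)
  then have L_pos: "L i > 0" for i
    by (simp add: L_def)
  have L_norm: "L i = norm (P' (i + 1) - P' i)" and L_norm'': "L i = norm (P'' (i + 1) - P'' i)" for i
    using assms(13)[of i] by (simp_all add: L_def dist_norm norm_minus_commute)
  define D where "D i = Q (i + 1) - Q i" for i
  have L2': "(L i)\<^sup>2 = (D i $ 1)\<^sup>2 + (D i $ 2)\<^sup>2" for i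
    by (simp add: L_norm norm_eq_sqrt_inner inner_vec_def sum_2 D_def Q_def flip: power2_eq_square)
  have "(d / ac * u - d / ac * v)\<^sup>2 = (d / ac)\<^sup>2 * (u - v)\<^sup>2" for u v
    by (simp only: right_diff_distrib[symmetric] power_mult_distrib)
  then have L2'': "(L i)\<^sup>2 = (d / ac)\<^sup>2 * (D i $ 1)\<^sup>2 + (D i $ 3)\<^sup>2" for i
    by (simp add: L_norm'' norm_eq_sqrt_inner inner_vec_def sum_2 D_def Q_def assms(14)
        flip: power2_eq_square)
  \<comment> \<open>Equating the two flat side lengths gives this relation. It makes the coefficient
    of \<open>s\<close> in the squared length vanish and, divided by the square of
    \<open>bc\<close>, is the isotropy \<open>iso\<close>.\<close>
  have D3: "(D i $ 3)\<^sup>2 = bc\<^sup>2 / ac\<^sup>2 * (D i $ 1)\<^sup>2 + (D i $ 2)\<^sup>2" for i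
    using L2'[of i] L2''[of i] d2 ac by (simp add: power_divide diff_divide_distrib algebra_simps)
  have iso: "(\<Sum>j\<in>UNIV. (D i $ j)\<^sup>2 / H $ j) = 0" for i
    using ac sq by (simp add: sum_3 H_def D3 add_divide_distrib)
  have P_diff: "P s i - P s j = diag_map (r s) (Q i - Q j)" for s i j
    by (simp add: P_def diag_map_diff)
  have norm_P: "norm (P s (i + 1) - P s i) = L i" if "s \<in> {0..1}" for s i
  proof -
    have "(norm (P s (i + 1) - P s i))\<^sup>2 =
        (1 - s * bc\<^sup>2 / ac\<^sup>2) * (D i $ 1)\<^sup>2 + (1 - s) * (D i $ 2)\<^sup>2 + s * (D i $ 3)\<^sup>2"
      unfolding power2_norm_eq_inner P_diff D_def[symmetric]
      by (simp add: inner_vec_def sum_3 power_mult_distrib r2[OF that] flip: power2_eq_square)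
    also have "\<dots> = (L i)\<^sup>2"
      unfolding D3 L2' by (simp add: algebra_simps)
    finally show ?thesis
      using L_pos[of i] by (simp add: less_imp_le)
  qed
  have P_ne: "P s i \<noteq> P s (i + 1)" if "s \<in> {0..1}" for s i
    using norm_P[OF that, of i] L_pos[of i] by auto

  \<comment> \<open>The reflection law in all poses\<close>
  define w where "w i = (1 / L i) *\<^sub>R D i" for i
  \<comment> \<open>In every pose \<open>diag_map (r s) (w i)\<close> is the unit direction of side
    \<open>i\<close>. Diagonal maps commute with \<open>normal_vec E\<close>, so the law for all
    \<open>s\<close> follows from this one relation at \<open>Q i\<close>.\<close>
  have w_law: "\<exists>c. w i $ 1 - w (i - 1) $ 1 = c * (Q i $ 1 / E $ 1) \<and>
      w i $ 2 - w (i - 1) $ 2 = c * (Q i $ 2 / E $ 2) \<and>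
      w i $ 3 - w (i - 1) $ 3 = c * (Q i $ 3 / E $ 3)" for i
  proof -
    have sgn': "sgn (P' (i + 1) - P' i) = (1 / L i) *\<^sub>R (P' (i + 1) - P' i)"
      and sgn'': "sgn (P'' (i + 1) - P'' i) = (1 / L i) *\<^sub>R (P'' (i + 1) - P'' i)" for i
      by (simp_all add: sgn_div_norm divide_inverse flip: L_norm L_norm'')
    have ell: "ellipse u v $ j > 0" if "u > 0" "v > 0" for u v j
      using that exhaust_2[of j] by (auto simp: ellipse_def)
    have ne'': "P'' i \<noteq> P'' (i + 1)" for i
      using assms(11) by (auto simp: billiard_def)
    obtain c where c: "sgn (P' (i + 1) - P' i) - sgn (P' i - P' (i - 1)) =
        c *\<^sub>R normal_vec (ellipse ae be) (P' i)"
      using assms(9) billiard_iff[of _ P', OF ell P'E ne] ae \<open>be > 0\<close> by blast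
    obtain c' where c': "sgn (P'' (i + 1) - P'' i) - sgn (P'' i - P'' (i - 1)) =
        c' *\<^sub>R normal_vec (ellipse ae (sqrt ke)) (P'' i)"
      using assms(11) billiard_iff[of _ P'', OF ell P''E ne''] ae \<open>ke > 0\<close> by (meson real_sqrt_gt_zero)
    note c = c[unfolded sgn' sgn'[of "i - 1", simplified]]
    note c' = c'[unfolded sgn'' sgn''[of "i - 1", simplified]]
    \<comment> \<open>The pose in the plane z = 0 controls the first two coordinates with factor
      \<open>c\<close>, the pose in y = 0 the third with factor \<open>c'\<close>; it remains to
      identify the two factors.\<close>
    have w1: "w i $ 1 - w (i - 1) $ 1 = c * (Q i $ 1 / E $ 1)"
      using arg_cong[OF c, of "\<lambda>v. v $ 1"] ae2 E_nth
      by (simp add: w_def D_def Q_def normal_vec_def ellipse_def)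
    have w2: "w i $ 2 - w (i - 1) $ 2 = c * (Q i $ 2 / E $ 2)"
      using arg_cong[OF c, of "\<lambda>v. v $ 2"] be2 E_nth
      by (simp add: w_def D_def Q_def normal_vec_def ellipse_def)
    have w3: "w i $ 3 - w (i - 1) $ 3 = c' * (Q i $ 3 / E $ 3)"
      using arg_cong[OF c', of "\<lambda>v. v $ 2"] ke2 E_nth
      by (simp add: w_def D_def Q_def normal_vec_def ellipse_def)
    \<comment> \<open>Both sides at \<open>Q i\<close> lie in the tangent plane of \<open>H\<close>,
      so the change of direction is orthogonal to its normal. Orthogonality of the normals of
      \<open>H\<close> and \<open>E\<close> then forces \<open>c = c'\<close>, also at vertices with
      vanishing x-coordinate.\<close>
    have "normal_vec H (Q i) \<bullet> D i = 0"
      using quadric_chord[OF QH QH, of i "i + 1"] iso[of i] by (simp add: D_def)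
    moreover have "normal_vec H (Q i) \<bullet> D (i - 1) = 0"
      using quadric_chord[OF QH QH, of i "i - 1"] iso[of "i - 1"]
      by (simp add: D_def inner_diff_right power2_commute)
    ultimately have "normal_vec H (Q i) \<bullet> (w i - w (i - 1)) = 0"
      by (simp add: w_def inner_diff_right)
    then have "c * ((Q i $ 1)\<^sup>2 / (ac\<^sup>2 * (ac\<^sup>2 + ke)) + (Q i $ 2)\<^sup>2 / (bc\<^sup>2 * (bc\<^sup>2 + ke))) =
        c' * ((Q i $ 3)\<^sup>2 / (bc\<^sup>2 * ke))"
      using w1 w2 w3 E_nth
      by (simp add: inner_vec_def sum_3 normal_vec_def H_def power2_eq_square algebra_simps)
    moreover have merged2: "(Q i $ 1)\<^sup>2 / (ac\<^sup>2 * (ac\<^sup>2 + ke)) + (Q i $ 2)\<^sup>2 / (bc\<^sup>2 * (bc\<^sup>2 + ke)) =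
        (Q i $ 3)\<^sup>2 / (bc\<^sup>2 * ke)"
      using merged(2)[of i] by (simp add: Q_def)
    moreover have "(Q i $ 3)\<^sup>2 / (bc\<^sup>2 * ke) \<noteq> 0"
    proof
      assume 0: "(Q i $ 3)\<^sup>2 / (bc\<^sup>2 * ke) = 0"
      have "(Q i $ 1)\<^sup>2 / (ac\<^sup>2 * (ac\<^sup>2 + ke)) \<ge> 0" "(Q i $ 2)\<^sup>2 / (bc\<^sup>2 * (bc\<^sup>2 + ke)) \<ge> 0"
        using \<open>ke > 0\<close> by auto
      with 0 merged2 have "(Q i $ 1)\<^sup>2 / (ac\<^sup>2 * (ac\<^sup>2 + ke)) = 0" "(Q i $ 2)\<^sup>2 / (bc\<^sup>2 * (bc\<^sup>2 + ke)) = 0"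
        by linarith+
      then have "Q i $ 1 = 0" "Q i $ 2 = 0"
        using E_pos[of 1] E_pos[of 2] E_nth ac2 sq by auto
      then show False
        using eq1[of i] by (simp add: Q_def)
    qed
    ultimately have "c = c'"
      by simp
    with w1 w2 w3 show ?thesis by blast
  qed

  have bill: "billiard E (P s)" if s: "s \<in> {0..1}" for s
    unfolding billiard_iff[of E "P s", OF E_pos PE[OF s] P_ne[OF s]]
  proof
    fix i
    have sgn_P: "sgn (P s (i + 1) - P s i) = diag_map (r s) (w i)" for i
      using norm_P[OF s, of i] unfolding sgn_div_norm P_diff w_def D_def[symmetric]
      by (simp add: linear_cmul[OF linear_diag_map] divide_inverse)
    obtain c where c: "w i $ 1 - w (i - 1) $ 1 = c * (Q i $ 1 / E $ 1)"
      "w i $ 2 - w (i - 1) $ 2 = c * (Q i $ 2 / E $ 2)"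
      "w i $ 3 - w (i - 1) $ 3 = c * (Q i $ 3 / E $ 3)"
      using w_law by blast
    have "diag_map (r s) (w i - w (i - 1)) = c *\<^sub>R normal_vec E (P s i)"
      by (simp add: vec_eq_iff forall_3 c normal_vec_def P_def)
    then show "\<exists>c. sgn (P s (i + 1) - P s i) - sgn (P s i - P s (i - 1)) = c *\<^sub>R normal_vec E (P s i)"
      using sgn_P[of i] sgn_P[of "i - 1"] by (auto simp: diag_map_diff)
  qed

  \<comment> \<open>Sides on focal axes\<close>
  have side0: "side_line (P 0) i \<in> (`) emb_xy ` tangent_lines (focal_ellipse E)" for i
  proof -
    have "P 0 = (\<lambda>i. emb_xy (P' i))" using P0 by auto
    then show ?thesis
      using assms(10) focal(1) by (auto simp: side_line_linear_image[OF linear_emb_xy] caustic_def)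
  qed
  have side1: "side_line (P 1) i \<in> (`) emb_xz ` tangent_lines (focal_hyperbola E)" for i
  proof -
    have "P 1 = (\<lambda>i. emb_xz (P'' i))" using P1 by auto
    then show ?thesis
      using assms(12) focal(2) by (auto simp: side_line_linear_image[OF linear_emb_xz] caustic_def)
  qed

  have k_one: "k s \<in> one_sheeted_params E" if "s \<in> {0<..<1}" for s
    using that sq unfolding focal k_def by simp
  have conf: "confocal E (k s) $ 1 = ac\<^sup>2 - s * bc\<^sup>2" "confocal E (k s) $ 2 = (1 - s) * bc\<^sup>2"
    "confocal E (k s) $ 3 = - (s * bc\<^sup>2)" for s
    by (simp_all add: confocal_def E_nth k_def algebra_simps)
  have conf_r: "confocal E (k s) $ j = (r s $ j)\<^sup>2 * H $ j" if "s \<in> {0..1}" for s j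
    using ac exhaust_3[of j] by (auto simp: conf H_def r2[OF that] left_diff_distrib)
  have conf_iff: "diag_map (r s) x \<in> quadric (confocal E (k s)) \<longleftrightarrow> x \<in> quadric H"
    if "s \<in> {0<..<1}" for s x
    using that r_nz[of s] by (intro diag_map_quadric_iff conf_r) auto
  have PH: "P s i \<in> quadric (confocal E (k s))" if "s \<in> {0<..<1}" for s i
    unfolding P_def conf_iff[OF that] by (rule QH)

  have focal_P: "focal_billiard E (P s)" if s: "s \<in> {0..1}" for s
  proof -
    \<comment> \<open>At either end a squared semiaxis of \<open>confocal E (k s)\<close> becomes 0;
      there the sides are tangents of the focal conics, by the caustics.\<close>
    consider "s = 0" | "s = 1" | "s \<in> {0<..<1}" using s by fastforce
    then have "side_line (P s) i \<in> focal_axes E" for i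
    proof cases
      case 1
      then show ?thesis using side0 by (simp add: focal_axes_def)
    next
      case 2
      then show ?thesis using side1 by (simp add: focal_axes_def)
    next
      case 3
      have "affine hull {Q i, Q (i + 1)} \<subseteq> quadric H"
        using isotropic_chord_subset_quadric[OF QH QH] iso[of i] unfolding D_def by blast
      moreover have "side_line (P s) i = diag_map (r s) ` (affine hull {Q i, Q (i + 1)})"
        using side_line_linear_image[OF linear_diag_map, of "r s" Q i]
        unfolding side_line_def P_def by simp
      ultimately have "side_line (P s) i \<subseteq> quadric (confocal E (k s))"
        using conf_iff[OF 3] by auto
      then have "side_line (P s) i \<in> generators (confocal E (k s))"
        using P_ne[OF s] unfolding generators_def side_line_def by blast
      then show ?thesis
        using k_one[OF 3] by (auto simp: focal_axes_def)
    qed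
    then show ?thesis
      using bill[OF s] by (simp add: focal_billiard_def)
  qed

  \<comment> \<open>Affine motion between the poses\<close>
  have affine: "affine_motion P"
    unfolding affine_motion_def
  proof (intro ballI)
    fix s t :: real assume s: "s \<in> {0<..<1}" and t: "t \<in> {0..1}"
    define q :: "real ^ 3" where "q = (\<chi> j. r t $ j / r s $ j)"
    have rs: "r s $ j \<noteq> 0" for j
      using r_nz[of s] s by auto
    have "P t i = diag_map q (P s i) + 0" for i
      using rs by (simp add: vec_eq_iff P_def q_def)
    moreover have "bij (diag_map q) \<longleftrightarrow> t \<in> {0<..<1}"
      unfolding bij_diag_map_iff r_nz[OF t, symmetric] using rs by (simp add: q_def)
    ultimately show "\<exists>g c. linear g \<and> (\<forall>i. P t i = g (P s i) + c) \<and> (bij g \<longleftrightarrow> t \<in> {0<..<1})"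
      using linear_diag_map by blast
  qed

  \<comment> \<open>Orthogonal trajectories of the confocal hyperboloids\<close>
  have orth: "orthogonal_trajectory E (\<lambda>s. P s i)" for i
    unfolding orthogonal_trajectory_def
  proof (intro ballI conjI)
    fix s :: real assume s: "s \<in> {0<..<1}"
    define n where "n = normal_vec (confocal E (k s)) (P s i)"
    show "\<exists>k\<in>one_sheeted_params E. P s i \<in> quadric (confocal E k)"
      using k_one PH s by blast
    have uniq: "l = k s" if "l \<in> one_sheeted_params E" "P s i \<in> quadric (confocal E l)" for l
      using quadric_confocal_unique[OF _ _ that(1) k_one[OF s] that(2) PH[OF s]] E_nth sq by simp
    \<comment> \<open>With \<open>u\<close> a squared scaling factor, this brings the entries of the
      normal into the form of derivatives of square roots.\<close>
    have cancel: "sqrt u * q / (m * u) = q / (m * sqrt u)" if "u > 0" for u q m :: real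
    proof -
      define v where "v = sqrt u"
      have "u = v * v" "v \<noteq> 0" using that by (simp_all add: v_def)
      then show ?thesis unfolding v_def[symmetric] by simp
    qed
    have root_pos: "1 - s * bc\<^sup>2 / ac\<^sup>2 > 0"
      using frac[of s] s by auto
    have "ac\<^sup>2 - s * bc\<^sup>2 = ac\<^sup>2 * (1 - s * bc\<^sup>2 / ac\<^sup>2)"
      using ac by (simp add: field_simps)
    then have conf1: "confocal E (k s) $ 1 = ac\<^sup>2 * (1 - s * bc\<^sup>2 / ac\<^sup>2)"
      unfolding conf .
    have "n $ 1 = sqrt (1 - s * bc\<^sup>2 / ac\<^sup>2) * Q i $ 1 / (ac\<^sup>2 * (1 - s * bc\<^sup>2 / ac\<^sup>2))"
      "n $ 2 = sqrt (1 - s) * Q i $ 2 / (bc\<^sup>2 * (1 - s))" "n $ 3 = - (sqrt s * Q i $ 3 / (bc\<^sup>2 * s))"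
      by (simp_all only: n_def normal_vec_def conf1 conf(2,3) P_def r_def vec_lambda_beta
          diag_map_nth vector_3 mult.commute[of _ "bc\<^sup>2"] divide_minus_right)
    then have n_nth: "n $ 1 = Q i $ 1 / (ac\<^sup>2 * sqrt (1 - s * bc\<^sup>2 / ac\<^sup>2))"
      "n $ 2 = Q i $ 2 / (bc\<^sup>2 * sqrt (1 - s))" "n $ 3 = - (Q i $ 3 / (bc\<^sup>2 * sqrt s))"
      using cancel[OF root_pos] cancel[of s] cancel[of "1 - s"] s by simp_all
    \<comment> \<open>Each coordinate is, up to a constant factor, the square root of the absolute
      value of a squared semiaxis of \<open>confocal E (k s)\<close>. These squared semiaxes all
      have the derivative of \<open>k\<close>, minus the square of \<open>bc\<close>; half of it is
      the factor between velocity and normal.\<close>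
    have "((\<lambda>s. P s i $ j) has_real_derivative (- (bc\<^sup>2 / 2) *\<^sub>R n) $ j) (at s)" for j
    proof -
      have "((\<lambda>s. sqrt (1 - s * bc\<^sup>2 / ac\<^sup>2) * Q i $ 1) has_real_derivative - (bc\<^sup>2 / 2) * n $ 1) (at s)"
        unfolding n_nth using root_pos ac by (auto intro!: derivative_eq_intros simp: field_simps)
      moreover have "((\<lambda>s. sqrt (1 - s) * Q i $ 2) has_real_derivative - (bc\<^sup>2 / 2) * n $ 2) (at s)"
        unfolding n_nth using s sq by (auto intro!: derivative_eq_intros simp: field_simps)
      moreover have "((\<lambda>s. sqrt s * Q i $ 3) has_real_derivative - (bc\<^sup>2 / 2) * n $ 3) (at s)"
        unfolding n_nth using s sq by (auto intro!: derivative_eq_intros simp: field_simps)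
      ultimately show ?thesis
        using exhaust_3[of j] by (auto simp: P_def r_def)
    qed
    then have "((\<lambda>s. P s i) has_vector_derivative - (bc\<^sup>2 / 2) *\<^sub>R n) (at s)"
      by (rule has_vector_derivative_vec)
    moreover have "- (bc\<^sup>2 / 2) *\<^sub>R n \<noteq> 0"
      using normal_vec_nonzero[OF PH[OF s]] sq unfolding n_def by simp
    moreover have "- (bc\<^sup>2 / 2) *\<^sub>R n \<in> span {n}"
      by (intro span_scale span_base) simp
    ultimately show "\<exists>v. v \<noteq> 0 \<and> ((\<lambda>s. P s i) has_vector_derivative v) (at s) \<and>
        (\<forall>k\<in>one_sheeted_params E. P s i \<in> quadric (confocal E k) \<longrightarrow>
          v \<in> span {normal_vec (confocal E k) (P s i)})"
      using uniq unfolding n_def by blast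
  qed

  have cont: "continuous_on {0..1} (\<lambda>s. P s i)" for i
  proof -
    have "continuous_on {0..1} (\<lambda>s. sqrt (1 - s * bc\<^sup>2 / ac\<^sup>2) * Q i $ 1)"
      "continuous_on {0..1} (\<lambda>s. sqrt (1 - s) * Q i $ 2)" "continuous_on {0..1} (\<lambda>s. sqrt s * Q i $ 3)"
      using ac by (intro continuous_intros; simp)+
    then have "continuous_on {0..1} (\<lambda>s. P s i $ j)" for j
      using exhaust_3[of j] by (auto simp: P_def r_def)
    then have "continuous_on {0..1} (\<lambda>s. \<chi> j. P s i $ j)"
      by (rule continuous_on_vec_lambda)
    then show ?thesis
      by simp
  qed

  have dist_P: "dist (P s i) (P s (i + 1)) = L i" if "s \<in> {0..1}" for s i
    using norm_P[OF that, of i] by (simp add: dist_norm norm_minus_commute)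
  show ?thesis
    by (intro exI[of _ P] conjI ballI allI cont focal_P P0 P1 affine orth side0 side1)
      (simp_all only: dist_P)
qed

end
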